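(* There exists an infinite uniformly recurrent word (over a finite alphabet) of bounded exponent which is not infinite closed-rich.
   Context: Infinite words are one-sided sequences over a finite alphabet. A factor of a word is a contiguous finite subword. An infinite word is uniformly recurrent if each of its factors occurs infinitely often with bounded gaps between consecutive occurrences. A period of a finite word $v=v_0\cdots v_{m-1}$ is an integer $t\ge 1$ with $v_{i+t}=v_i$ for all $0\le i<m-t$; the exponent of a non-empty finite word $v$ is $|v|/t$ where $t$ is its shortest period. The exponent of an infinite word is the supremum of the exponents of its non-empty factors; it is bounded if this supremum is finite. A border of a finite word $v$ is a proper prefix of $v$ which is also a suffix of $v$. A finite word $v$ is closed if $|v|\le 1$, or if $|v|\ge 2$ and the longest border of $v$ is non-empty and occurs in $v$ exactly twice (as a prefix and as a suffix). An infinite word $w$ is (infinite) closed-rich if there exists a constant $C>0$ such that for each $n\in\mathbb{N}$ each factor of $w$ of length $n$ contains at least $Cn^2$ distinct closed factors. *)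

theory Defs
  imports
    Complex_Main
    "HOL-Library.Extended_Real"
    "HOL-Library.Sublist"
    "HOL-Library.Omega_Words_Fun"
begin

text \<open>
  Infinite words are the functions of type \<open>'a word\<close> from \<open>Omega_Words_Fun\<close>; finite words are lists.
  Both \<open>Sublist\<close> and \<open>Omega_Words_Fun\<close> define constants called \<open>prefix\<close> and \<open>suffix\<close>, so the
  former are always qualified below.
\<close>

definition occurs_at :: "'a list \<Rightarrow> 'a word \<Rightarrow> nat \<Rightarrow> bool" where
  "occurs_at u w i \<longleftrightarrow> w [i \<rightarrow> i + length u] = u"

definition factor :: "'a list \<Rightarrow> 'a word \<Rightarrow> bool" where
  "factor u w \<longleftrightarrow> (\<exists>i. occurs_at u w i)"

definition uniformly_recurrent :: "'a word \<Rightarrow> bool" where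
  "uniformly_recurrent w \<longleftrightarrow>
    (\<forall>u. factor u w \<longrightarrow>
      infinite {i. occurs_at u w i} \<and>
      (\<exists>g. \<forall>i j. i < j \<and> occurs_at u w i \<and> occurs_at u w j \<and>
                 (\<forall>k. i < k \<and> k < j \<longrightarrow> \<not> occurs_at u w k) \<longrightarrow> j - i \<le> g))"

definition is_period :: "nat \<Rightarrow> 'a list \<Rightarrow> bool" where
  "is_period t v \<longleftrightarrow> t \<ge> 1 \<and> (\<forall>i. i + t < length v \<longrightarrow> v ! (i + t) = v ! i)"

text \<open>The length of a non-empty word is one of its periods, so the minimum below exists.\<close>

definition exponent :: "'a list \<Rightarrow> real" where
  "exponent v = real (length v) / real (LEAST t. is_period t v)"

definition word_exponent :: "'a word \<Rightarrow> ereal" where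
  "word_exponent w = (SUP v \<in> {v. factor v w \<and> v \<noteq> []}. ereal (exponent v))"

definition bounded_exponent :: "'a word \<Rightarrow> bool" where
  "bounded_exponent w \<longleftrightarrow> word_exponent w < \<infinity>"

text \<open>Borders may be empty, and their occurrences as prefix and as suffix may overlap.\<close>

definition border :: "'a list \<Rightarrow> 'a list \<Rightarrow> bool" where
  "border u v \<longleftrightarrow> strict_prefix u v \<and> Sublist.suffix u v"

definition longest_border :: "'a list \<Rightarrow> 'a list \<Rightarrow> bool" where
  "longest_border u v \<longleftrightarrow> border u v \<and> (\<forall>u'. border u' v \<longrightarrow> length u' \<le> length u)"

definition occurrences :: "'a list \<Rightarrow> 'a list \<Rightarrow> nat set" where
  "occurrences u v = {i. i + length u \<le> length v \<and> take (length u) (drop i v) = u}"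

text \<open>
  A border is a proper prefix, so its occurrences as a prefix and as a suffix are distinct, and
  cardinality 2 means that there are no others.
\<close>

definition closed_word :: "'a list \<Rightarrow> bool" where
  "closed_word v \<longleftrightarrow>
    length v \<le> 1 \<or>
    length v \<ge> 2 \<and> (\<exists>u. longest_border u v \<and> u \<noteq> [] \<and> card (occurrences u v) = 2)"

definition closed_rich :: "'a word \<Rightarrow> bool" where
  "closed_rich w \<longleftrightarrow>
    (\<exists>C::real. C > 0 \<and>
      (\<forall>n v. factor v w \<and> length v = n \<longrightarrow>
        real (card {u. sublist u v \<and> closed_word u}) \<ge> C * real n ^ 2))"

end

theory Submission
  imports Defs "HOL-Computational_Algebra.Nth_Powers"
begin

text \<open>
  Write \<open>n + 1 = 2 ^ k * (2 * m + 1)\<close> and let the \<open>n\<close>-th letter record the parity of \<open>k\<close> and whether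
  \<open>m mod (k + 1)\<^sup>2\<close> is a square. Every letter recurs along an arithmetic progression starting at its
  position (a Toeplitz word), which gives uniform recurrence. The parities of \<open>k\<close> form the
  period-doubling word, in which a repetition at distance \<open>d\<close>, with \<open>2 ^ r\<close> the exact power of two
  dividing \<open>d\<close>, has length less than \<open>2 ^ (r + 2) \<le> 4 * d\<close>; this bounds the exponent.

  Put \<open>M = 2 ^ (k + 1)\<close> and \<open>Q = k + 1\<close>. In the prefix of length \<open>n = M * Q\<^sup>2\<close> no word of length
  \<open>L = 4 * M * Q\<close> occurs twice: the distance would be a multiple of \<open>M\<close>, and then the second component
  would shift two consecutive squares onto two squares. A closed factor is determined by its position
  and the length of its longest border, hence this prefix has at most \<open>1 + n * L\<close> closed factors,
  which is \<open>o(n\<^sup>2)\<close> as \<open>Q\<close> grows.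
\<close>

subsection \<open>Counting closed factors\<close>

text \<open>The longest border of a closed factor has no third occurrence, so the factor ends where
  its border first returns; start and border length determine it. The summand 1 counts the empty
  word.\<close>

lemma card_closed_factors_le:
  assumes no_repeat: "\<And>i j. i < j \<Longrightarrow> j + L \<le> length v \<Longrightarrow> take L (drop i v) \<noteq> take L (drop j v)"
    and "0 < L"
  shows "card {u. sublist u v \<and> closed_word u} \<le> 1 + length v * L"
proof -
  (* F (i, l) runs from position i to the end of the next occurrence of the factor of length l found at
     i; for l = 0 it is the single letter at i. *)
  define F where "F = (\<lambda>(i, l). take ((LEAST m. 0 < m \<and> take l (drop (i + m) v) = take l (drop i v)) + l)
    (drop i v))"
  have "u \<in> insert [] (F ` ({..<length v} \<times> {..<L}))" if "sublist u v" "closed_word u" for u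
  proof (cases "u = []")
    case False
    obtain xs ys where v: "v = xs @ u @ ys"
      using \<open>sublist u v\<close> by (auto simp: sublist_def)
    define i where "i = length xs"
    have drop_v: "drop (i + m) v = drop m u @ ys" if "m \<le> length u" for m
      using that by (simp add: v i_def)
    have i: "i < length v"
      using False by (simp add: v i_def)
    consider "length u = 1"
      | b where "longest_border b u" "card (occurrences b u) = 2" "length u \<ge> 2"
      using \<open>closed_word u\<close> False by (auto simp: closed_word_def le_Suc_eq)
    then have "\<exists>l<L. u = F (i, l)"
    proof cases
      case 1
      have "(LEAST m::nat. 0 < m) = 1"
        by (rule Least_equality) auto
      then have "u = F (i, 0)"
        using drop_v[of 0] 1 by (simp add: F_def)
      with \<open>0 < L\<close> show ?thesis by blast
    next
      case 2
      define l where "l = length b"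
      define m where "m = length u - l"
      have "strict_prefix b u" "Sublist.suffix b u"
        using 2 by (auto simp: longest_border_def border_def)
      then have "l < length u" "take l u = b"
        by (auto simp: l_def prefix_length_less strict_prefix_def Sublist.prefix_def)
      moreover have "drop m u = b"
        using \<open>Sublist.suffix b u\<close> by (auto simp: l_def m_def Sublist.suffix_def)
      ultimately have b: "l < length u" "take l u = b" "drop m u = b" by auto
      then have m: "0 < m" "m + l = length u" "m \<le> length u"
        using b by (auto simp: m_def)
      have "{0, m} \<subseteq> occurrences b u"
        using m b by (auto simp: occurrences_def l_def)
      then have occ: "occurrences b u = {0, m}"
        using 2 m by (intro card_seteq[symmetric]) (auto intro: card_ge_0_finite)
      have repeat: "take l (drop (i + m) v) = take l (drop i v)"
        using drop_v[of m] drop_v[of 0] m b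
        by (simp add: l_def)
      \<comment> \<open>A border of length at least \<open>L\<close> would make its first
        \<open>L\<close> letters occur twice in \<open>v\<close>.\<close>
      have "l < L"
      proof (rule ccontr)
        assume "\<not> l < L"
        then have "take L (drop (i + m) v) = take L (drop i v)"
          using arg_cong[OF repeat, of "take L"] by (simp add: min_absorb1)
        moreover have "i + m + L \<le> length v"
          using \<open>\<not> l < L\<close> m by (simp add: v i_def)
        ultimately show False
          using no_repeat[of i "i + m"] m by auto
      qed
      \<comment> \<open>An earlier return would be a third occurrence of \<open>b\<close> in
        \<open>u\<close>.\<close>
      moreover have "(LEAST m. 0 < m \<and> take l (drop (i + m) v) = take l (drop i v)) = m"
      proof (rule Least_equality)
        fix m' assume m': "0 < m' \<and> take l (drop (i + m') v) = take l (drop i v)"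
        show "m \<le> m'"
        proof (rule ccontr)
          assume "\<not> m \<le> m'"
          then have "m' + l \<le> length u"
            using m by simp
          then have "take l (drop m' u) = b"
            using m' drop_v[of m'] drop_v[of 0] b by simp
          then have "m' \<in> occurrences b u"
            using \<open>m' + l \<le> length u\<close> by (simp add: occurrences_def l_def)
          then show False
            using occ m' \<open>\<not> m \<le> m'\<close> by auto
        qed
      qed (use m repeat in auto)
      then have "F (i, l) = u"
        using drop_v[of 0] m by (simp add: F_def)
      ultimately show ?thesis by blast
    qed
    then show ?thesis
      using i by auto
  qed simp
  then have "card {u. sublist u v \<and> closed_word u} \<le> card (insert [] (F ` ({..<length v} \<times> {..<L})))"
    by (intro card_mono) auto
  also have "\<dots> \<le> Suc (card (F ` ({..<length v} \<times> {..<L})))"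
    by (rule card_insert_le_m1) auto
  also have "\<dots> \<le> 1 + length v * L"
    using card_image_le[of "{..<length v} \<times> {..<L}" F] by simp
  finally show ?thesis .
qed

subsection \<open>Toeplitz words\<close>

lemma occurs_at_iff_nth: "occurs_at u w i \<longleftrightarrow> (\<forall>j<length u. w (i + j) = u ! j)"
  unfolding occurs_at_def list_eq_iff_nth_eq by simp

text \<open>Finitely many positions share a common step: the product of their individual
  steps.\<close>

lemma toeplitz_prefix:
  fixes w :: "'a word"
  assumes "\<And>n. \<exists>T>0. \<forall>c. w (n + c * T) = w n"
  shows "\<exists>T>0. \<forall>n<N. \<forall>c. w (n + c * T) = w n"
proof (induction N)
  case 0
  show ?case by (intro exI[of _ 1]) simp
next
  case (Suc N)
  then obtain T where T: "T > 0" "\<forall>n<N. \<forall>c. w (n + c * T) = w n" by blast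
  obtain S where S: "S > 0" "\<forall>c. w (N + c * S) = w N" using assms by blast
  have "w (n + c * (S * T)) = w n" if "n < Suc N" for n c
  proof (cases "n = N")
    case True
    have "c * (S * T) = (c * T) * S" by (simp add: mult_ac)
    then show ?thesis using True S(2) by metis
  next
    case False
    have "c * (S * T) = (c * S) * T" by (simp add: mult_ac)
    moreover have "n < N" using that False by simp
    ultimately show ?thesis using T(2) by metis
  qed
  moreover have "S * T > 0" using T(1) S(1) by simp
  ultimately show ?case by blast
qed

lemma uniformly_recurrent_toeplitz:
  fixes w :: "'a word"
  assumes "\<And>n. \<exists>T>0. \<forall>c. w (n + c * T) = w n"
  shows "uniformly_recurrent w"
  unfolding uniformly_recurrent_def
proof (intro allI impI conjI)
  fix u assume "factor u w"
  then obtain i where i: "occurs_at u w i" by (auto simp: factor_def)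
  obtain T where T: "T > 0" "\<forall>n<i + length u. \<forall>c. w (n + c * T) = w n"
    using toeplitz_prefix[of w "i + length u"] assms by blast
  have occ: "occurs_at u w (i + c * T)" for c
    unfolding occurs_at_iff_nth
  proof (intro allI impI)
    fix j assume "j < length u"
    then have "w (i + j + c * T) = u ! j"
      using T(2) i by (simp add: occurs_at_iff_nth)
    then show "w (i + c * T + j) = u ! j" by (simp add: add_ac)
  qed
  show "infinite {i. occurs_at u w i}"
    unfolding infinite_nat_iff_unbounded_le
  proof
    fix m
    have "m \<le> i + m * T" using T by (simp add: trans_le_add2)
    with occ show "\<exists>n\<ge>m. n \<in> {i. occurs_at u w i}" by blast
  qed
  show "\<exists>g. \<forall>a b. a < b \<and> occurs_at u w a \<and> occurs_at u w b \<and>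
    (\<forall>k. a < k \<and> k < b \<longrightarrow> \<not> occurs_at u w k) \<longrightarrow> b - a \<le> g"
  proof (intro exI[of _ "i + T"] allI impI, elim conjE)
    fix a b
    assume gap: "\<forall>k. a < k \<and> k < b \<longrightarrow> \<not> occurs_at u w k"
    \<comment> \<open>\<open>i + c * T\<close> is the first term of the progression after
      \<open>a\<close>. For \<open>a < i\<close> it is \<open>i\<close> itself, hence the extra
      \<open>i\<close> in the gap bound.\<close>
    define c where "c = (if a < i then 0 else Suc ((a - i) div T))"
    have "a < i + c * T \<and> i + c * T \<le> a + (i + T)"
    proof (cases "a < i")
      case False
      have "a - i < T + (a - i) div T * T" "(a - i) div T * T \<le> a - i"
        using T(1) by (simp_all add: dividend_less_div_times)
      with False show ?thesis
        unfolding c_def by (simp only: if_False mult_Suc) linarith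
    qed (simp add: c_def)
    moreover from this have "\<not> i + c * T < b"
      using gap occ[of c] by blast
    ultimately show "b - a \<le> i + T" by linarith
  qed
qed

subsection \<open>The word\<close>

text \<open>Both components are packed as binary digits. Reducing \<open>m\<close> makes
  \<open>letter k\<close> periodic in \<open>m\<close>, as the Toeplitz property needs; the growing
  modulus leaves ever longer runs of squares intact.\<close>

definition letter :: "nat \<Rightarrow> nat \<Rightarrow> nat" where
  "letter k m = k mod 2 + 2 * of_bool (is_nth_power 2 (m mod (Suc k)\<^sup>2))"

text \<open>The shift to \<open>Suc n\<close> avoids 0, which has no odd part.\<close>

definition square_toeplitz :: "nat word" where
  "square_toeplitz n = letter (multiplicity 2 (Suc n)) (Suc n div 2 ^ Suc (multiplicity 2 (Suc n)))"

lemma letter_eqD: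
  assumes "letter k m = letter k' m'"
  shows "even k = even k'"
    and "is_nth_power 2 (m mod (Suc k)\<^sup>2) = is_nth_power 2 (m' mod (Suc k')\<^sup>2)"
proof -
  have parity: "even (letter k m) = even k" for k m
    by (simp add: letter_def even_iff_mod_2_eq_zero)
  have half: "letter k m div 2 = of_bool (is_nth_power 2 (m mod (Suc k)\<^sup>2))" for k m
    by (simp add: letter_def)
  show "even k = even k'"
    using assms parity[of k m] parity[of k' m'] by simp
  show "is_nth_power 2 (m mod (Suc k)\<^sup>2) = is_nth_power 2 (m' mod (Suc k')\<^sup>2)"
    using assms half[of k m] half[of k' m'] by (simp only: of_bool_eq_iff)
qed

lemma square_toeplitz_eq:
  assumes "Suc n = 2 ^ k * (2 * m + 1)"
  shows "square_toeplitz n = letter k m"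
proof -
  have "multiplicity 2 (Suc n) = k"
  proof (rule multiplicity_eqI)
    have "\<not> 2 ^ k * 2 dvd 2 ^ k * (2 * m + 1)"
      by (subst dvd_times_left_cancel_iff) auto
    then show "\<not> 2 ^ Suc k dvd Suc n"
      by (simp only: assms power_Suc2 not_False_eq_True)
  qed (use assms in simp)
  moreover have "Suc n div 2 ^ Suc k = m"
  proof -
    have "Suc n = 2 ^ k + m * 2 ^ Suc k" by (simp add: assms)
    then show ?thesis by (simp only: div_mult_self1) simp
  qed
  ultimately show ?thesis by (simp add: square_toeplitz_def)
qed

lemma pos_nat_odd_part:
  fixes n :: nat
  assumes "n > 0"
  obtains k m where "n = 2 ^ k * (2 * m + 1)"
proof -
  obtain y where "n = 2 ^ multiplicity 2 n * y" "odd y"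
    using multiplicity_decompose'[of n 2] assms by auto
  with that show ?thesis by (metis oddE)
qed

lemma finite_range_square_toeplitz: "finite (range square_toeplitz)"
proof (rule finite_subset)
  show "range square_toeplitz \<subseteq> {..3}"
    by (auto simp: square_toeplitz_def letter_def of_bool_def)
qed simp

lemma square_toeplitz_recurs: "\<exists>T>0. \<forall>c. square_toeplitz (n + c * T) = square_toeplitz n"
proof -
  obtain k m where km: "Suc n = 2 ^ k * (2 * m + 1)"
    by (rule pos_nat_odd_part[of "Suc n"]) auto
  \<comment> \<open>This step keeps the power of two and changes \<open>m\<close> by a multiple of
    the modulus.\<close>
  have "square_toeplitz (n + c * (2 ^ Suc k * (Suc k)\<^sup>2)) = square_toeplitz n" for c
  proof -
    have "Suc (n + c * (2 ^ Suc k * (Suc k)\<^sup>2)) = Suc n + c * (2 ^ Suc k * (Suc k)\<^sup>2)"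
      by simp
    also have "\<dots> = 2 ^ k * (2 * (m + c * (Suc k)\<^sup>2) + 1)"
      unfolding km by (simp add: algebra_simps)
    finally have "square_toeplitz (n + c * (2 ^ Suc k * (Suc k)\<^sup>2)) = letter k (m + c * (Suc k)\<^sup>2)"
      by (rule square_toeplitz_eq)
    then show ?thesis
      by (simp add: square_toeplitz_eq[OF km] letter_def)
  qed
  then show ?thesis by (intro exI[of _ "2 ^ Suc k * (Suc k)\<^sup>2"]) auto
qed

section \<open>Bounded exponent from the parities of the 2-adic valuations\<close>

text \<open>If \<open>Suc n = 2 ^ r * (2 * x + 1)\<close> with \<open>x + e\<close> even, then
  \<open>Suc n + d\<close> is an odd multiple of \<open>2 ^ Suc r\<close>, so the parity components
  differ. Such positions recur with step \<open>4 * 2 ^ r\<close>.\<close>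

lemma square_toeplitz_mismatch:
  assumes d: "d = 2 ^ r * (2 * e + 1)"
  obtains n where "i \<le> n" "n < i + 2 ^ (r + 2)" "square_toeplitz n \<noteq> square_toeplitz (n + d)"
proof -
  define R :: nat where "R = 2 ^ r"
  \<comment> \<open>The least \<open>x\<close> with \<open>i < R * (2 * x + 1)\<close>; adjusting
    its parity to that of \<open>e\<close> costs at most another \<open>2 * R\<close>.\<close>
  define x0 where "x0 = (i + R) div (2 * R)"
  define x where "x = (if even (x0 + e) then x0 else Suc x0)"
  define n where "n = R * (2 * x + 1) - 1"
  have "R > 0" by (simp add: R_def)
  then have x0: "2 * R * x0 \<le> i + R" "i + R < 2 * R * x0 + 2 * R"
    using dividend_less_times_div[of "2 * R" "i + R"]
    by (auto simp: x0_def times_div_less_eq_dividend)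
  have "even (x + e)" by (simp add: x_def)
  then obtain y where y: "x + e = 2 * y" by (rule evenE)
  have n: "Suc n = R * (2 * x + 1)"
    using \<open>R > 0\<close> by (simp add: n_def)
  have "i < Suc n \<and> Suc n \<le> i + 4 * R"
    unfolding n using x0 by (auto simp: x_def algebra_simps)
  then have "i \<le> n" "n < i + 2 ^ (r + 2)"
    by (auto simp: R_def)
  moreover have "square_toeplitz n \<noteq> square_toeplitz (n + d)"
  proof -
    have "Suc (n + d) = Suc n + d" by simp
    also have "\<dots> = 2 * R * (x + e + 1)"
      unfolding n d by (simp add: R_def algebra_simps)
    also have "\<dots> = 2 ^ Suc r * (2 * y + 1)"
      unfolding y by (simp add: R_def)
    finally have "square_toeplitz (n + d) = letter (Suc r) y" by (rule square_toeplitz_eq)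
    moreover have "square_toeplitz n = letter r x"
      using n by (intro square_toeplitz_eq) (simp add: R_def)
    ultimately show ?thesis
      using letter_eqD(1)[of r x "Suc r" y] by auto
  qed
  ultimately show ?thesis by (rule that)
qed

lemma length_le_period_square_toeplitz:
  assumes "factor v square_toeplitz" "is_period t v"
  shows "length v \<le> 5 * t"
proof (rule ccontr)
  assume long: "\<not> length v \<le> 5 * t"
  obtain i where i: "occurs_at v square_toeplitz i"
    using assms by (auto simp: factor_def)
  have v: "v ! j = square_toeplitz (i + j)" if "j < length v" for j
    using i that by (simp add: occurs_at_iff_nth)
  have "t > 0" using assms by (simp add: is_period_def)
  then obtain r e where t: "t = 2 ^ r * (2 * e + 1)" by (rule pos_nat_odd_part)
  obtain n where n: "i \<le> n" "n < i + 2 ^ (r + 2)" "square_toeplitz n \<noteq> square_toeplitz (n + t)"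
    by (rule square_toeplitz_mismatch[OF t])
  \<comment> \<open>The mismatch starts within the first \<open>4 * t\<close> letters;
    \<open>t\<close> more make room for the shifted position.\<close>
  have "2 ^ (r + 2) \<le> 4 * t" by (simp add: t)
  then have "n - i + t < length v"
    using n long by linarith
  then have "v ! (n - i + t) = v ! (n - i)"
    using assms by (simp add: is_period_def)
  then show False
    using v[of "n - i + t"] v[of "n - i"] n \<open>n - i + t < length v\<close> by simp
qed

lemma bounded_exponent_square_toeplitz: "bounded_exponent square_toeplitz"
proof -
  have "ereal (exponent v) \<le> ereal 5" if "factor v square_toeplitz" "v \<noteq> []" for v
  proof -
    have "is_period (length v) v"
      using that by (auto simp: is_period_def Suc_le_eq)
    then have period: "is_period (LEAST t. is_period t v) v" by (rule LeastI)
    have "length v \<le> 5 * (LEAST t. is_period t v)"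
      using that(1) period by (rule length_le_period_square_toeplitz)
    then have "real (length v) \<le> 5 * real (LEAST t. is_period t v)" by linarith
    moreover have "(LEAST t. is_period t v) > 0"
      using period unfolding is_period_def[of "LEAST t. is_period t v"] by linarith
    ultimately have "exponent v \<le> 5"
      by (simp add: exponent_def divide_le_eq)
    then show ?thesis by (simp only: ereal_less_eq)
  qed
  then have "word_exponent square_toeplitz \<le> ereal 5"
    unfolding word_exponent_def by (intro SUP_least) auto
  also have "ereal 5 < \<infinity>" by simp
  finally show ?thesis by (simp add: bounded_exponent_def)
qed

section \<open>Long prefixes with few closed factors\<close>

text \<open>Gaps between squares grow: since \<open>a < b\<close>, the gap after
  \<open>b\<^sup>2\<close> exceeds \<open>2 * a + 1\<close>, the gap that the shift
  preserves.\<close>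

lemma no_shifted_squares:
  fixes a b c e :: nat
  assumes "e > 0" "a\<^sup>2 + e = b\<^sup>2" "(Suc a)\<^sup>2 + e = c\<^sup>2"
  shows False
proof -
  have "a\<^sup>2 < b\<^sup>2" "b\<^sup>2 < c\<^sup>2" using assms by (auto simp: power2_eq_square)
  then have "a < b" "Suc b \<le> c" by (auto dest: power_less_imp_less_base)
  have "(Suc b)\<^sup>2 \<le> c\<^sup>2" using \<open>Suc b \<le> c\<close> by (rule power_mono) simp
  then show False using assms \<open>a < b\<close> by (simp add: power2_eq_square)
qed

lemma square_toeplitz_no_repeat:
  fixes k :: nat
  defines "M \<equiv> 2 ^ Suc k" and "Q \<equiv> Suc k"
  assumes "i < j" and bound: "j + 4 * M * Q \<le> M * Q\<^sup>2"
  shows "\<exists>x<4 * M * Q. square_toeplitz (i + x) \<noteq> square_toeplitz (j + x)"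
proof (rule ccontr)
  assume no_mismatch: "\<not> ?thesis"
  have agree: "square_toeplitz n = square_toeplitz (n + (j - i))"
    if "i \<le> n" "n < i + 4 * M * Q" for n
  proof -
    have "n - i < 4 * M * Q" using that by linarith
    with no_mismatch have "square_toeplitz (i + (n - i)) = square_toeplitz (j + (n - i))" by blast
    moreover have "i + (n - i) = n" "j + (n - i) = n + (j - i)" using that \<open>i < j\<close> by auto
    ultimately show ?thesis by simp
  qed
  have "j - i > 0" using \<open>i < j\<close> by simp
  then obtain r e' where d: "j - i = 2 ^ r * (2 * e' + 1)" by (rule pos_nat_odd_part)
  \<comment> \<open>Otherwise the window is long enough to contain a parity mismatch.\<close>
  have "k < r"
  proof (rule ccontr)
    assume "\<not> k < r"
    then have "(2::nat) ^ (r + 2) \<le> 2 ^ (k + 2)" by (intro power_increasing) auto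
    also have "\<dots> \<le> 4 * M * Q" by (simp add: M_def Q_def)
    finally have "(2::nat) ^ (r + 2) \<le> 4 * M * Q" .
    moreover obtain n where "i \<le> n" "n < i + 2 ^ (r + 2)"
      "square_toeplitz n \<noteq> square_toeplitz (n + (j - i))"
      by (rule square_toeplitz_mismatch[OF d])
    ultimately show False using agree[of n] by auto
  qed
  then have "M dvd j - i"
    unfolding M_def d by (intro dvd_mult2 le_imp_power_dvd) simp
  then obtain e where e: "j - i = M * e" by (rule dvdE)
  then have "e > 0" using \<open>i < j\<close> by (cases e) auto
  \<comment> \<open>The position \<open>n\<close> with
    \<open>Suc n = 2 ^ k * (2 * s\<^sup>2 + 1)\<close> carries the square \<open>s\<^sup>2\<close>,
    and the shift by \<open>M * e\<close> adds \<open>e\<close> to it. The bound keeps the sum below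
    \<open>Q\<^sup>2\<close>, so the reduction does nothing.\<close>
  have shifted: "is_nth_power 2 (s\<^sup>2 + e)" if s: "i < M * s\<^sup>2 + 2 ^ k" "M * s\<^sup>2 + 2 ^ k \<le> i + 4 * M * Q" for s
  proof -
    define n where "n = M * s\<^sup>2 + 2 ^ k - 1"
    have n: "Suc n = M * s\<^sup>2 + 2 ^ k" by (simp add: n_def)
    have "M * (s\<^sup>2 + e) < M * Q\<^sup>2"
    proof -
      have "M * (s\<^sup>2 + e) < M * s\<^sup>2 + 2 ^ k + (j - i)" by (simp add: e algebra_simps)
      also have "\<dots> \<le> M * Q\<^sup>2" using s bound \<open>i < j\<close> by linarith
      finally show ?thesis .
    qed
    then have "s\<^sup>2 + e < Q\<^sup>2" by simp
    have "square_toeplitz n = square_toeplitz (n + (j - i))"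
      using agree[of n] n s by simp
    moreover have "square_toeplitz n = letter k (s\<^sup>2)"
      using n by (intro square_toeplitz_eq) (simp add: M_def)
    moreover have "square_toeplitz (n + (j - i)) = letter k (s\<^sup>2 + e)"
    proof (rule square_toeplitz_eq)
      have "Suc (n + (j - i)) = M * s\<^sup>2 + 2 ^ k + M * e" using n e by simp
      then show "Suc (n + (j - i)) = 2 ^ k * (2 * (s\<^sup>2 + e) + 1)" by (simp add: M_def algebra_simps)
    qed
    ultimately have "is_nth_power 2 (s\<^sup>2 mod Q\<^sup>2) = is_nth_power 2 ((s\<^sup>2 + e) mod Q\<^sup>2)"
      unfolding Q_def by (intro letter_eqD(2)) simp
    then show ?thesis
      using \<open>s\<^sup>2 + e < Q\<^sup>2\<close> by simp
  qed
  \<comment> \<open>The first square in the window. The next one also fits: with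
    \<open>a = Suc b\<close>, it lies \<open>4 * M * Suc b\<close> beyond that of \<open>b\<close>,
    which precedes the window, and \<open>b < Q\<close>.\<close>
  define a where "a = (LEAST a. i < M * a\<^sup>2 + 2 ^ k)"
  have "i < M * (Suc i)\<^sup>2 + 2 ^ k"
  proof -
    have "i < (Suc i)\<^sup>2" by (simp add: power2_eq_square)
    also have "\<dots> \<le> M * (Suc i)\<^sup>2" by (simp add: M_def)
    finally show ?thesis by simp
  qed
  then have a: "i < M * a\<^sup>2 + 2 ^ k"
    unfolding a_def by (rule LeastI[of "\<lambda>a. i < M * a\<^sup>2 + 2 ^ k"])
  have "M * (Suc a)\<^sup>2 + 2 ^ k \<le> i + 4 * M * Q"
  proof (cases a)
    case 0
    then show ?thesis by (simp add: M_def Q_def)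
  next
    case (Suc b)
    then have b: "M * b\<^sup>2 + 2 ^ k \<le> i"
      using not_less_Least[of b "\<lambda>a. i < M * a\<^sup>2 + 2 ^ k"] by (simp add: a_def not_less)
    have "M * b\<^sup>2 < M * Q\<^sup>2"
      using b bound \<open>i < j\<close> by linarith
    then have "b < Q" by (auto dest: power_less_imp_less_base)
    then have "M * (4 * Suc b) \<le> M * (4 * Q)" by (intro mult_le_mono) auto
    moreover have "M * (Suc a)\<^sup>2 = M * b\<^sup>2 + M * (4 * Suc b)"
      unfolding Suc by (simp add: power2_eq_square algebra_simps)
    moreover have "M * (4 * Q) = 4 * M * Q" by simp
    ultimately show ?thesis using b by linarith
  qed
  moreover have "M * a\<^sup>2 \<le> M * (Suc a)\<^sup>2"
    by (intro mult_le_mono2 power_mono) auto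
  ultimately have "is_nth_power 2 (a\<^sup>2 + e)" "is_nth_power 2 ((Suc a)\<^sup>2 + e)"
    using a by (intro shifted; linarith)+
  then show False
    using no_shifted_squares[OF \<open>e > 0\<close>] by (auto simp: is_nth_power_def)
qed

lemma not_closed_rich_square_toeplitz: "\<not> closed_rich square_toeplitz"
proof
  assume "closed_rich square_toeplitz"
  then obtain C :: real where "C > 0" and rich:
    "\<And>v. factor v square_toeplitz \<Longrightarrow>
      C * real (length v) ^ 2 \<le> real (card {u. sublist u v \<and> closed_word u})"
    unfolding closed_rich_def by blast
  \<comment> \<open>The count below is at most \<open>n * (5 * M * Q)\<close>, that is 5/Q times the
    square of \<open>n\<close>, so richness would force \<open>C * Q \<le> 5\<close>.\<close>
  obtain k :: nat where k: "5 / C < real k" using reals_Archimedean2 by blast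
  define M :: nat where "M = 2 ^ Suc k"
  define Q where "Q = Suc k"
  define n where "n = M * Q\<^sup>2"
  define v where "v = square_toeplitz [0 \<rightarrow> n]"
  have pos: "M > 0" "Q > 0" "n > 0" by (auto simp: M_def Q_def n_def)
  have len: "length v = n" by (simp add: v_def)
  have "occurs_at v square_toeplitz 0" by (simp add: occurs_at_def v_def)
  then have "C * real n ^ 2 \<le> real (card {u. sublist u v \<and> closed_word u})"
    using rich[of v] len by (auto simp: factor_def)
  also have "card {u. sublist u v \<and> closed_word u} \<le> 1 + length v * (4 * M * Q)"
  proof (rule card_closed_factors_le)
    fix i j assume ij: "i < j" "j + 4 * M * Q \<le> length v"
    then obtain x where x: "x < 4 * M * Q" "square_toeplitz (i + x) \<noteq> square_toeplitz (j + x)"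
      using square_toeplitz_no_repeat[of i j k] by (auto simp: M_def Q_def len n_def)
    have "take (4 * M * Q) (drop i v) ! x = square_toeplitz (i + x)"
      "take (4 * M * Q) (drop j v) ! x = square_toeplitz (j + x)"
      using x ij by (auto simp: v_def)
    with x(2) show "take (4 * M * Q) (drop i v) \<noteq> take (4 * M * Q) (drop j v)"
      by (intro notI) (simp only:)
  qed (use pos in simp)
  also have "1 + length v * (4 * M * Q) \<le> n * (5 * M * Q)"
  proof -
    have "1 \<le> n * (M * Q)" using pos by (simp add: Suc_le_eq)
    then show ?thesis by (simp add: len algebra_simps)
  qed
  finally have "C * real n ^ 2 \<le> real (n * (5 * M * Q))" by simp
  moreover have "C * real n ^ 2 = (real n * (real M * real Q)) * (C * real Q)"
    by (simp add: n_def power2_eq_square)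
  moreover have "real (n * (5 * M * Q)) = (real n * (real M * real Q)) * 5" by simp
  moreover have "0 < real n * (real M * real Q)" using pos by simp
  ultimately have "C * real Q \<le> 5"
    by (simp only: mult_le_cancel_left_pos)
  moreover have "5 < C * real Q"
    using k \<open>C > 0\<close> by (simp add: Q_def field_simps)
  ultimately show False by simp
qed

theorem corollary4:
  shows "\<exists>w :: nat word. finite (range w) \<and> uniformly_recurrent w \<and> bounded_exponent w \<and>
           \<not> closed_rich w"
  using finite_range_square_toeplitz uniformly_recurrent_toeplitz[OF square_toeplitz_recurs]
    bounded_exponent_square_toeplitz not_closed_rich_square_toeplitz
  by blast

end
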